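(* Let $K$ be an ordered field and let $(V,W)$ be a dense pair of ordered vector spaces over $K$. Let $\phi(x;y)$ be the partitioned formula $$(y\le x\ \wedge\ x<y+1)\ \vee\ U(x-y),$$ where $x$ and $y$ are single variables. Then the VC-density of $\phi(x;y)$ in $(V,W)$ is $2$.
   Context: **Dense pairs of ordered vector spaces.** Let $L_{\mathrm{ovs}}=\{+,-,0,1,<\}\cup\{\ell_\lambda:\lambda\in K\}$, where each $\ell_\lambda$ is a unary function symbol interpreted as scalar multiplication by $\lambda$, and $1$ is interpreted as a distinguished positive element. Let $L_{\mathrm{ovs}}^d=L_{\mathrm{ovs}}\cup\{U\}$ with $U$ a unary relation symbol. A dense pair $(V,W)$ is an $L_{\mathrm{ovs}}^d$-structure where $V$ is an ordered $K$-vector space and $U$ is interpreted as a proper $K$-linear subspace $W$ of $V$ containing $1$ that is dense in $V$ (for all $a<b$ in $V$ there is $w\in W$ with $a<w<b$). **VC-density.** Let $\mathcal M$ be a structure with universe $M$ and $\phi(x;y)$ a formula whose free variables are split into object variables $x=(x_1,\dots,x_m)$ and parameter variables $y=(y_1,\dots,y_n)$. For $A\subseteq M^m$ put $A\cap\phi(\mathcal M;y)=\{A\cap\phi(\mathcal M;b):b\in M^n\}$, where $\phi(\mathcal M;b)=\{a\in M^m:\mathcal M\models\phi(a;b)\}$. The shatter function is $\pi_\phi(k)=\max\{|A\cap\phi(\mathcal M;y)|:A\subseteq M^m,\ |A|=k\}$. The VC-density of $\phi(x;y)$ in $\mathcal M$ is the infimum of the real numbers $r$ such that $\pi_\phi(k)=O(k^r)$.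 *)

theory Defs
  imports "HOL-Library.Landau_Symbols" "HOL-Library.Extended_Real"
begin

section \<open>First-order formulas and structures\<close>

text \<open>
  Function symbols come from \<open>'f\<close>, relation symbols from \<open>'r\<close>; constants are function symbols
  applied to the empty list. Arities are not enforced: a structure interprets each symbol on all
  argument lists, but only lists of the intended length matter. The universe of a structure is the
  whole type \<open>'a\<close>.
\<close>

datatype 'f trm = Var nat | App 'f "'f trm list"

datatype ('f, 'r) form =
    Eq "'f trm" "'f trm"
  | Rel 'r "'f trm list"
  | Neg "('f, 'r) form"
  | Conj "('f, 'r) form" "('f, 'r) form"
  | Disj "('f, 'r) form" "('f, 'r) form"
  | Exists nat "('f, 'r) form"
  | Forall nat "('f, 'r) form"

record ('f, 'r, 'a) fo_structure =
  fun_interp :: "'f \<Rightarrow> 'a list \<Rightarrow> 'a"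
  rel_interp :: "'r \<Rightarrow> 'a list \<Rightarrow> bool"

primrec trm_val :: "('f, 'r, 'a) fo_structure \<Rightarrow> (nat \<Rightarrow> 'a) \<Rightarrow> 'f trm \<Rightarrow> 'a" where
  "trm_val M e (Var i) = e i"
| "trm_val M e (App f ts) = fun_interp M f (map (trm_val M e) ts)"

primrec sat :: "('f, 'r, 'a) fo_structure \<Rightarrow> (nat \<Rightarrow> 'a) \<Rightarrow> ('f, 'r) form \<Rightarrow> bool" where
  "sat M e (Eq s t) \<longleftrightarrow> trm_val M e s = trm_val M e t"
| "sat M e (Rel r ts) \<longleftrightarrow> rel_interp M r (map (trm_val M e) ts)"
| "sat M e (Neg p) \<longleftrightarrow> \<not> sat M e p"
| "sat M e (Conj p q) \<longleftrightarrow> sat M e p \<and> sat M e q"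
| "sat M e (Disj p q) \<longleftrightarrow> sat M e p \<or> sat M e q"
| "sat M e (Exists i p) \<longleftrightarrow> (\<exists>a. sat M (e(i := a)) p)"
| "sat M e (Forall i p) \<longleftrightarrow> (\<forall>a. sat M (e(i := a)) p)"

section \<open>VC-density\<close>

text \<open>
  A partitioned formula with \<open>m\<close> object and \<open>n\<close> parameter variables is a formula whose free
  variables are among \<open>Var 0, \<dots>, Var (m + n - 1)\<close>; the first \<open>m\<close> are the object variables and the
  remaining \<open>n\<close> the parameter variables. Tuples are lists. The values \<open>(a @ b) ! i\<close> for
  \<open>i \<ge> m + n\<close> are irrelevant for such formulas.
\<close>

definition defined_set ::
  "('f, 'r, 'a) fo_structure \<Rightarrow> nat \<Rightarrow> ('f, 'r) form \<Rightarrow> 'a list \<Rightarrow> 'a list set" where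
  "defined_set M m \<phi> b = {a. length a = m \<and> sat M (\<lambda>i. (a @ b) ! i) \<phi>}"

definition trace_family ::
  "('f, 'r, 'a) fo_structure \<Rightarrow> nat \<Rightarrow> nat \<Rightarrow> ('f, 'r) form \<Rightarrow> 'a list set \<Rightarrow> 'a list set set" where
  "trace_family M m n \<phi> A = {A \<inter> defined_set M m \<phi> b | b. length b = n}"

text \<open>
  The maximum is over a nonempty set (of numbers at most \<open>2 ^ k\<close>) whenever the structure is infinite
  and \<open>m > 0\<close>. The condition \<open>finite A\<close> is needed because infinite sets have \<open>card\<close> zero.
\<close>

definition shatter_function ::
  "('f, 'r, 'a) fo_structure \<Rightarrow> nat \<Rightarrow> nat \<Rightarrow> ('f, 'r) form \<Rightarrow> nat \<Rightarrow> nat" where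
  "shatter_function M m n \<phi> k =
     Max {card (trace_family M m n \<phi> A) | A. A \<subseteq> {a. length a = m} \<and> finite A \<and> card A = k}"

text \<open>The infimum is taken in the extended reals, so it is \<open>\<infinity>\<close> if there is no such \<open>r\<close>.\<close>

definition vc_density ::
  "('f, 'r, 'a) fo_structure \<Rightarrow> nat \<Rightarrow> nat \<Rightarrow> ('f, 'r) form \<Rightarrow> ereal" where
  "vc_density M m n \<phi> =
     Inf {ereal r | r. (\<lambda>k. real (shatter_function M m n \<phi> k)) \<in> O(\<lambda>k. real k powr r)}"

section \<open>Dense pairs of ordered vector spaces\<close>

locale ordered_vector_space = vector_space scale
  for scale :: "'k::linordered_field \<Rightarrow> 'v::linordered_ab_group_add \<Rightarrow> 'v" +
  assumes scale_pos: "0 < c \<Longrightarrow> 0 < v \<Longrightarrow> 0 < scale c v"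

locale dense_pair = ordered_vector_space scale
  for scale :: "'k::linordered_field \<Rightarrow> 'v::linordered_ab_group_add \<Rightarrow> 'v" +
  fixes unit :: 'v and W :: "'v set"
  assumes unit_pos: "0 < unit"
    and subspace_W: "subspace W"
    and proper: "W \<noteq> UNIV"
    and unit_in_W: "unit \<in> W"
    and dense: "a < b \<Longrightarrow> \<exists>w\<in>W. a < w \<and> w < b"

datatype 'k ovs_fun = Plus | Minus | Zero | One | Scale 'k

datatype ovsd_rel = Less | U

text \<open>\<open>Minus\<close> is binary subtraction.\<close>

fun ovs_fun_interp ::
  "('k \<Rightarrow> 'v::ab_group_add \<Rightarrow> 'v) \<Rightarrow> 'v \<Rightarrow> 'k ovs_fun \<Rightarrow> 'v list \<Rightarrow> 'v" where
  "ovs_fun_interp scale unit Plus [a, b] = a + b"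
| "ovs_fun_interp scale unit Minus [a, b] = a - b"
| "ovs_fun_interp scale unit Zero [] = 0"
| "ovs_fun_interp scale unit One [] = unit"
| "ovs_fun_interp scale unit (Scale c) [a] = scale c a"
| "ovs_fun_interp scale unit _ _ = 0"

fun ovsd_rel_interp :: "'v::ord set \<Rightarrow> ovsd_rel \<Rightarrow> 'v list \<Rightarrow> bool" where
  "ovsd_rel_interp W Less [a, b] \<longleftrightarrow> a < b"
| "ovsd_rel_interp W U [a] \<longleftrightarrow> a \<in> W"
| "ovsd_rel_interp W _ _ \<longleftrightarrow> False"

definition pair_structure ::
  "('k \<Rightarrow> 'v::linordered_ab_group_add \<Rightarrow> 'v) \<Rightarrow> 'v \<Rightarrow> 'v set \<Rightarrow>
     ('k ovs_fun, ovsd_rel, 'v) fo_structure" where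
  "pair_structure scale unit W =
     \<lparr>fun_interp = ovs_fun_interp scale unit, rel_interp = ovsd_rel_interp W\<rparr>"

abbreviation less_form :: "'f trm \<Rightarrow> 'f trm \<Rightarrow> ('f, ovsd_rel) form" where
  "less_form s t \<equiv> Rel Less [s, t]"

abbreviation le_form :: "'f trm \<Rightarrow> 'f trm \<Rightarrow> ('f, ovsd_rel) form" where
  "le_form s t \<equiv> Disj (less_form s t) (Eq s t)"

text \<open>The formula \<open>(y \<le> x \<and> x < y + 1) \<or> U (x - y)\<close> with object variable \<open>x\<close> and parameter
  variable \<open>y\<close>.\<close>

definition interval_or_coset :: "('k ovs_fun, ovsd_rel) form" where
  "interval_or_coset =
     (let x = Var 0; y = Var 1 in
        Disj (Conj (le_form y x) (less_form x (App Plus [y, App One []])))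
             (Rel U [App Minus [x, y]]))"

end

theory Submission imports Defs begin

text \<open>
  Write \<open>S b = [b, b + 1) \<union> (b + W)\<close>. On a set \<open>A\<close> of size \<open>k\<close>, the trace of \<open>[b, b + 1)\<close> depends
  only on the numbers of elements of \<open>A\<close> below \<open>b\<close> and below \<open>b + 1\<close>. Both grow with \<open>b\<close>, so they
  are determined by their sum, which has at most \<open>2 k + 1\<close> values. The trace of \<open>b + W\<close> is empty or
  the trace of the coset of an element of \<open>A\<close>. Hence there are at most \<open>(2 k + 1) (k + 1)\<close> traces.

  Conversely, take \<open>n\<close> equally spaced points of \<open>W\<close> in \<open>(0, 1]\<close> and \<open>n\<close> negative points in
  different cosets of \<open>W\<close> other than \<open>W\<close>. As every coset is dense, \<open>b\<close> can be chosen in any of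
  these cosets and in any of the \<open>n\<close> gaps between the points of \<open>W\<close>; this gives \<open>n\<^sup>2\<close> traces on
  \<open>2 n\<close> points.
\<close>

section \<open>From formulas on one-element lists to sets of points\<close>

definition interval_or_coset_set :: "'v::linordered_ab_group_add \<Rightarrow> 'v set \<Rightarrow> 'v \<Rightarrow> 'v set" where
  "interval_or_coset_set u W b = {x. (b \<le> x \<and> x < b + u) \<or> x - b \<in> W}"

lemma defined_set_interval_or_coset:
  "defined_set (pair_structure scale u W) 1 interval_or_coset [b] =
     (\<lambda>x. [x]) ` interval_or_coset_set u W b"
  by (auto simp: defined_set_def interval_or_coset_def interval_or_coset_set_def
      pair_structure_def Let_def length_Suc_conv)

lemma card_trace_family_interval_or_coset:
  fixes A :: "'v::linordered_ab_group_add set"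
  shows
  "card (trace_family (pair_structure scale u W) 1 1 interval_or_coset ((\<lambda>x. [x]) ` A)) =
     card (range (\<lambda>b. A \<inter> interval_or_coset_set u W b))"
proof -
  have inj: "inj (\<lambda>x::'v. [x])"
    by (simp add: inj_def)
  have "trace_family (pair_structure scale u W) 1 1 interval_or_coset ((\<lambda>x. [x]) ` A) =
      range (\<lambda>b. (\<lambda>x. [x]) ` A \<inter> defined_set (pair_structure scale u W) 1 interval_or_coset [b])"
    by (auto simp: trace_family_def length_Suc_conv)
  also have "\<dots> = image (\<lambda>x. [x]) ` range (\<lambda>b. A \<inter> interval_or_coset_set u W b)"
    unfolding defined_set_interval_or_coset image_Int[OF inj, symmetric] by (simp add: image_image)
  finally show ?thesis
    using inj by (simp add: card_image inj_on_image inj_on_subset inj_image_eq_iff inj_on_def)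
qed

lemma shatter_function_interval_or_coset:
  fixes u :: "'v::linordered_ab_group_add"
  shows
  "shatter_function (pair_structure scale u W) 1 1 interval_or_coset k =
     Max {card (range (\<lambda>b. A \<inter> interval_or_coset_set u W b)) | A. finite A \<and> card A = k}"
proof -
  have inj: "inj_on (\<lambda>x::'v. [x]) B" for B
    by (simp add: inj_on_def)
  have eq: "{A. A \<subseteq> {a::'v list. length a = 1} \<and> finite A \<and> card A = k} =
      image (\<lambda>x. [x]) ` {A. finite A \<and> card A = k}" (is "?L = ?R")
  proof
    show "?L \<subseteq> ?R"
    proof
      fix A :: "'v list set" assume A: "A \<in> ?L"
      then have hd: "[hd a] = a" if "a \<in> A" for a
        using that by (auto simp: length_Suc_conv)
      then have "A = (\<lambda>x. [x]) ` (hd ` A)"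
        by (force simp: image_image)
      moreover have "inj_on hd A"
        using hd by (metis inj_onI)
      ultimately show "A \<in> ?R"
        using A by (intro image_eqI[of _ _ "hd ` A"]) (auto simp: card_image)
    qed
  qed (auto simp: card_image[OF inj])
  show ?thesis
    unfolding shatter_function_def setcompr_eq_image eq image_image
      card_trace_family_interval_or_coset ..
qed

text \<open>Equal sums force each of the two counts to agree, and nested finite sets of equal size
  coincide.\<close>

lemma interval_or_coset_trace_eqI:
  fixes A :: "'v::linordered_ab_group_add set"
  assumes "finite A"
    and eq: "card {x \<in> A. x < b} + card {x \<in> A. x < b + u} =
      card {x \<in> A. x < b'} + card {x \<in> A. x < b' + u}"
    and coset: "{x \<in> A. x - b \<in> W} = {x \<in> A. x - b' \<in> W}"
  shows "A \<inter> interval_or_coset_set u W b = A \<inter> interval_or_coset_set u W b'"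
proof -
  \<comment> \<open>The order \<open>c \<le> d\<close> makes the initial segments of
    \<open>A\<close> nested; linearity later covers \<open>b\<close> and \<open>b'\<close> in either
    order.\<close>
  have *: "(x < c \<longleftrightarrow> x < d) \<and> (x < c + u \<longleftrightarrow> x < d + u)"
    if "c \<le> d" and e: "card {x \<in> A. x < c} + card {x \<in> A. x < c + u} =
      card {x \<in> A. x < d} + card {x \<in> A. x < d + u}" and "x \<in> A" for c d x
  proof -
    have sub: "{x \<in> A. x < c} \<subseteq> {x \<in> A. x < d}" "{x \<in> A. x < c + u} \<subseteq> {x \<in> A. x < d + u}"
      using \<open>c \<le> d\<close> by (auto intro: less_le_trans add_right_mono)
    have fin: "finite {x \<in> A. x < d}" "finite {x \<in> A. x < d + u}"
      using \<open>finite A\<close> by auto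
    have "card {x \<in> A. x < c} = card {x \<in> A. x < d}"
      "card {x \<in> A. x < c + u} = card {x \<in> A. x < d + u}"
      using card_mono[OF fin(1) sub(1)] card_mono[OF fin(2) sub(2)] e by linarith+
    then show ?thesis
      using \<open>x \<in> A\<close> card_subset_eq[OF fin(1) sub(1)] card_subset_eq[OF fin(2) sub(2)] by blast
  qed
  have below: "(x < b \<longleftrightarrow> x < b') \<and> (x < b + u \<longleftrightarrow> x < b' + u)" if "x \<in> A" for x
    using *[OF _ eq that] *[OF _ eq[symmetric] that] linear[of b b'] by blast
  have "x - b \<in> W \<longleftrightarrow> x - b' \<in> W" if "x \<in> A" for x
    using coset that by blast
  then show ?thesis
    using below by (auto simp: interval_or_coset_set_def not_less[symmetric])
qed

text \<open>\<open>f\<close> factors through \<open>h\<close>, since \<open>inv h\<close> picks a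
  preimage of each value of \<open>h\<close>. It will be applied to the pair of count sum and coset
  trace.\<close>

lemma card_range_le_if_factors:
  assumes "finite T" "range h \<subseteq> T" "\<And>x y. h x = h y \<Longrightarrow> f x = f y"
  shows "card (range f) \<le> card T"
proof -
  have "f x = f (inv h (h x))" for x
    by (rule assms(3)) (simp add: f_inv_into_f)
  then have "range f = (\<lambda>t. f (inv h t)) ` range h"
    unfolding image_image by (rule image_cong[OF refl])
  then show ?thesis
    by (metis assms(1,2) card_image_le card_mono finite_subset le_trans)
qed

context dense_pair
begin

section \<open>Upper bound on the number of traces\<close>

lemma card_traces_le:
  assumes "finite A" and card: "card A = k"
  shows "card (range (\<lambda>b. A \<inter> interval_or_coset_set unit W b)) \<le> (2 * k + 1) * (k + 1)"
proof -
  define f where "f b = card {x \<in> A. x < b} + card {x \<in> A. x < b + unit}" for b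
  define g where "g b = {x \<in> A. x - b \<in> W}" for b
  \<comment> \<open>The extra \<open>{}\<close> stands for the parameters \<open>b\<close> whose
    coset \<open>b + W\<close> misses \<open>A\<close>.\<close>
  define T where "T = {..2 * k} \<times> insert {} (g ` A)"
  have fin: "finite T"
    using \<open>finite A\<close> by (simp add: T_def)
  have "g b = g a" if "a \<in> g b" for a b
  proof -
    have "x - b \<in> W \<longleftrightarrow> x - a \<in> W" for x
      using that subspace_diff[OF subspace_W, of "x - b" "a - b"]
        subspace_add[OF subspace_W, of "x - a" "a - b"] by (auto simp: g_def)
    then show ?thesis
      by (simp add: g_def)
  qed
  moreover have "g b \<subseteq> A" for b
    by (simp add: g_def)
  ultimately have g: "g b \<in> insert {} (g ` A)" for b
    by (metis equals0I imageI insertCI subsetD)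
  have "f b \<le> 2 * k" for b
    using card_mono[OF \<open>finite A\<close>, of "{x \<in> A. x < b}"] card_mono[OF \<open>finite A\<close>, of "{x \<in> A. x < b + unit}"]
    by (auto simp: f_def card)
  with g have sub: "range (\<lambda>b. (f b, g b)) \<subseteq> T"
    by (auto simp: T_def)
  have "card (range (\<lambda>b. A \<inter> interval_or_coset_set unit W b)) \<le> card T"
    by (rule card_range_le_if_factors[OF fin sub], rule interval_or_coset_trace_eqI[OF \<open>finite A\<close>])
      (simp_all add: f_def g_def)
  also have "\<dots> = (2 * k + 1) * card (insert {} (g ` A))"
    by (simp add: T_def card_cartesian_product)
  also have "\<dots> \<le> (2 * k + 1) * (k + 1)"
    using card_image_le[OF \<open>finite A\<close>, of g] \<open>finite A\<close> card by (intro mult_le_mono2) (simp add: card_insert_if)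
  finally show ?thesis .
qed

section \<open>Lower bound on the number of traces\<close>

lemma scale_strict_mono:
  assumes "c < d" "0 < v"
  shows "scale c v < scale d v"
  using scale_pos[of "d - c" v] assms by (simp add: scale_left_diff_distrib)

text \<open>Ensures that sets \<open>A\<close> of every size exist, so that the maximum in the
  shatter function is over a nonempty set.\<close>

lemma infinite_UNIV: "infinite (UNIV :: 'v set)"
proof -
  have "inj (\<lambda>n::nat. scale (of_nat n) unit)"
    by (rule linorder_injI) (metis scale_strict_mono unit_pos of_nat_less_iff less_irrefl)
  then show ?thesis
    using finite_subset[OF subset_UNIV] finite_imageD infinite_UNIV_nat by blast
qed

lemma obtain_pos_not_in_W:
  obtains v where "0 < v" "v \<notin> W"
proof -
  obtain v where v: "v \<notin> W"
    using proper by blast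
  then have "v \<noteq> 0" "- v \<notin> W"
    using subspace_0[OF subspace_W] subspace_neg[OF subspace_W, of "- v"] by auto
  with v that[of v] that[of "- v"] show thesis
    by (cases "0 < v") auto
qed

lemma exists_many_traces:
  assumes "0 < n"
  shows "\<exists>A. finite A \<and> card A = 2 * n \<and>
    n\<^sup>2 \<le> card (range (\<lambda>b. A \<inter> interval_or_coset_set unit W b))"
proof -
  obtain v where v: "0 < v" "v \<notin> W"
    by (rule obtain_pos_not_in_W)
  \<comment> \<open>The point \<open>w 0 = 0\<close> stays outside \<open>A\<close>; it is only the
    left end of the first gap, and \<open>w n = unit\<close> closes the last one.\<close>
  define w where "w i = scale (of_nat i / of_nat n) unit" for i
  \<comment> \<open>\<open>Suc j\<close> makes every point negative and avoids the coset
    \<open>W\<close> itself. Distinct multiples of \<open>v\<close> differ by a nonzero multiple of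
    \<open>v\<close>, which cannot lie in \<open>W\<close>.\<close>
  define z where "z j = scale (- of_nat (Suc j)) v" for j
  define A where "A = w ` {1..n} \<union> z ` {..<n}"
  have w_less: "w i < w i'" if "i < i'" for i i'
    unfolding w_def using that \<open>0 < n\<close>
    by (intro scale_strict_mono unit_pos) (simp add: divide_strict_right_mono)
  have w_le: "w i \<le> w i'" if "i \<le> i'" for i i'
    using w_less that by (metis le_less)
  have w_W: "w i \<in> W" for i
    unfolding w_def by (intro subspace_scale[OF subspace_W] unit_in_W)
  have w_0: "w 0 = 0" and w_n: "w n = unit"
    using \<open>0 < n\<close> by (simp_all add: w_def)
  have coset: "c = 0" if "scale c v \<in> W" for c
    using subspace_scale[OF subspace_W that, of "inverse c"] v(2) by (cases "c = 0") simp_all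
  have z_neg: "z j < 0" for j
    using scale_strict_mono[of "- of_nat (Suc j)" 0 v] v(1) by (simp add: z_def del: of_nat_Suc)
  have z_diff: "j = j'" if "z j - z j' \<in> W" for j j'
  proof -
    have "scale (of_nat j' - of_nat j) v \<in> W"
      using that by (simp add: z_def scale_left_diff_distrib scale_left_distrib)
    then show ?thesis
      using coset by fastforce
  qed
  have z_W: "z j \<notin> W" for j
    using coset[of "- of_nat (Suc j)"] by (auto simp: z_def simp del: of_nat_Suc)
  have w_neq_z: "w i \<noteq> z j" for i j
    using w_W z_W by metis
  have inj_w: "inj_on w B" for B
    using w_less by (metis inj_onI less_irrefl linorder_neqE_nat)
  have inj_z: "inj_on z B" for B
    using z_diff subspace_0[OF subspace_W] by (auto simp: inj_on_def)
  have "finite A"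
    by (simp add: A_def)
  have "card A = card (w ` {1..n}) + card (z ` {..<n})"
    unfolding A_def using w_neq_z by (intro card_Un_disjoint) auto
  then have card_A: "card A = 2 * n"
    by (simp add: card_image inj_w inj_z)
  \<comment> \<open>Density of the coset \<open>z j + W\<close>: translate the gap by
    \<open>- z j\<close>, find a point of \<open>W\<close> there, and translate back.\<close>
  have "\<exists>b. w i < b \<and> b < w (Suc i) \<and> b - z j \<in> W" for i j
  proof -
    obtain x where "x \<in> W" "w i - z j < x" "x < w (Suc i) - z j"
      using dense[of "w i - z j" "w (Suc i) - z j"] w_less[of i "Suc i"] by auto
    then show ?thesis
      by (intro exI[of _ "x + z j"]) (simp add: less_diff_eq diff_less_eq)
  qed
  then obtain b where b: "w i < b i j" "b i j < w (Suc i)" "b i j - z j \<in> W" for i j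
    by metis
  \<comment> \<open>The coset of \<open>b i j\<close> is not \<open>W\<close>, so it contains no
    \<open>w i'\<close>; and \<open>b i j > 0\<close> puts the right end of the interval beyond
    \<open>unit\<close>. Hence the left end decides.\<close>
  have w_trace: "w i' \<in> interval_or_coset_set unit W (b i j) \<longleftrightarrow> i < i'"
    if "i' \<le> n" for i i' j
  proof -
    have "b i j \<notin> W"
      using subspace_diff[OF subspace_W _ b(3)[of i j], of "b i j"] z_W[of j] by auto
    then have "w i' - b i j \<notin> W"
      using subspace_diff[OF subspace_W w_W[of i'], of "w i' - b i j"] by auto
    moreover have "w i' < b i j + unit"
      using w_le[OF that] w_le[of 0 i] b(1)[of i j] unfolding w_0 w_n
      by (auto intro: le_less_trans less_add_same_cancel2[THEN iffD2])
    moreover have "b i j \<le> w i' \<longleftrightarrow> i < i'"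
      using b(1,2)[of i j] w_le[of i' i] w_le[of "Suc i" i']
      by (cases "i < i'") (auto simp: not_less)
    ultimately show ?thesis
      by (simp add: interval_or_coset_set_def)
  qed
  \<comment> \<open>All \<open>z j'\<close> lie to the left of the interval, so membership is
    decided by the coset.\<close>
  have z_trace: "z j' \<in> interval_or_coset_set unit W (b i j) \<longleftrightarrow> j' = j" for i j j'
  proof -
    have "\<not> b i j \<le> z j'"
      using z_neg[of j'] b(1)[of i j] w_le[of 0 i] unfolding w_0 by auto
    moreover have "z j' - b i j \<in> W \<longleftrightarrow> j' = j"
      using subspace_add[OF subspace_W _ b(3)[of i j], of "z j' - b i j"] z_diff[of j' j]
        subspace_neg[OF subspace_W b(3)[of i j]] by auto
    ultimately show ?thesis
      by (simp add: interval_or_coset_set_def)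
  qed
  have "inj_on (\<lambda>(i, j). A \<inter> interval_or_coset_set unit W (b i j)) ({..<n} \<times> {..<n})"
  proof (rule inj_onI, clarsimp)
    fix i j i' j'
    assume less: "i < n" "j < n" "i' < n" "j' < n"
      and eq: "A \<inter> interval_or_coset_set unit W (b i j) = A \<inter> interval_or_coset_set unit W (b i' j')"
    have "z j \<in> A"
      using less by (auto simp: A_def)
    then have "z j \<in> interval_or_coset_set unit W (b i' j')"
      using eq z_trace[of j i j] by blast
    then have "j = j'"
      by (simp add: z_trace)
    moreover have trace: "i < l \<longleftrightarrow> i' < l" if "0 < l" "l \<le> n" for l
    proof -
      have "w l \<in> A"
        using that by (auto simp: A_def)
      then have "w l \<in> interval_or_coset_set unit W (b i j) \<longleftrightarrow>
          w l \<in> interval_or_coset_set unit W (b i' j')"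
        using eq by blast
      then show ?thesis
        by (simp add: w_trace that)
    qed
    \<comment> \<open>If the indices differed, the larger one would be an admissible
      \<open>l\<close> and \<open>trace\<close> would fail there.\<close>
    have "i = i'"
      using trace[of i] trace[of i'] less by (cases i i' rule: linorder_cases) auto
    ultimately show "i = i' \<and> j = j'"
      by simp
  qed
  then have "n\<^sup>2 = card ((\<lambda>(i, j). A \<inter> interval_or_coset_set unit W (b i j)) ` ({..<n} \<times> {..<n}))"
    by (simp add: card_image power2_eq_square)
  also have "\<dots> \<le> card (range (\<lambda>b. A \<inter> interval_or_coset_set unit W b))"
  proof (rule card_mono)
    show "finite (range (\<lambda>b. A \<inter> interval_or_coset_set unit W b))"
      using \<open>finite A\<close> by (auto intro: finite_subset[of _ "Pow A"])
  qed auto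
  finally show ?thesis
    using \<open>finite A\<close> card_A by blast
qed

section \<open>Growth of the shatter function and the density\<close>

abbreviation shatter :: "nat \<Rightarrow> nat" where
  "shatter \<equiv> shatter_function (pair_structure scale unit W) 1 1 interval_or_coset"

lemma finite_trace_cards:
  "finite {card (range (\<lambda>b. A \<inter> interval_or_coset_set unit W b)) | A. finite A \<and> card A = k}"
  by (rule finite_subset[OF _ finite_atMost[of "(2 * k + 1) * (k + 1)"]])
    (clarify, erule card_traces_le, rule refl)

lemma shatter_le: "shatter k \<le> (2 * k + 1) * (k + 1)"
proof -
  obtain A :: "'v set" where "finite A" "card A = k"
    using infinite_arbitrarily_large[OF infinite_UNIV] by blast
  then show ?thesis
    unfolding shatter_function_interval_or_coset
    by (intro Max.boundedI finite_trace_cards) (blast, clarify, rule card_traces_le)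
qed

lemma shatter_ge:
  assumes "0 < n"
  shows "n\<^sup>2 \<le> shatter (2 * n)"
proof -
  obtain A where A: "finite A" "card A = 2 * n"
    and le: "n\<^sup>2 \<le> card (range (\<lambda>b. A \<inter> interval_or_coset_set unit W b))"
    using exists_many_traces[OF assms] by blast
  note le
  also have "card (range (\<lambda>b. A \<inter> interval_or_coset_set unit W b)) \<le> shatter (2 * n)"
    unfolding shatter_function_interval_or_coset
    using A by (intro Max_ge[OF finite_trace_cards]) blast
  finally show ?thesis .
qed

lemma shatter_bigo: "(\<lambda>k. real (shatter k)) \<in> O(\<lambda>k. real k powr 2)"
\<comment> \<open>For \<open>k \<ge> 1\<close> the bound \<open>(2 * k + 1) * (k + 1)\<close> is at
  most \<open>(3 * k) * (2 * k)\<close>.\<close>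
proof (rule bigoI[of _ 6])
  show "\<forall>\<^sub>F k in at_top. norm (real (shatter k)) \<le> 6 * norm (real k powr 2)"
    using eventually_gt_at_top[of 0]
  proof eventually_elim
    case (elim k)
    have "shatter k \<le> (2 * k + 1) * (k + 1)"
      by (rule shatter_le)
    also have "\<dots> \<le> (3 * k) * (2 * k)"
      using elim by (intro mult_mono) auto
    finally have "real (shatter k) \<le> real ((3 * k) * (2 * k))"
      by (rule of_nat_mono)
    then show ?case
      using elim by (simp add: power2_eq_square)
  qed
qed

text \<open>Even arguments suffice: the factor \<open>2 powr r\<close> from
  \<open>(2 * n) powr r\<close> is absorbed, and comparing powers of \<open>n\<close> gives the
  bound.\<close>

lemma two_le_if_shatter_bigo:
  assumes "(\<lambda>k. real (shatter k)) \<in> O(\<lambda>k. real k powr r)"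
  shows "2 \<le> r"
proof -
  have "(\<lambda>n. real n powr 2) \<in> O(\<lambda>n. real (shatter (2 * n)))"
  proof (rule bigoI[of _ 1])
    show "\<forall>\<^sub>F n in at_top. norm (real n powr 2) \<le> 1 * norm (real (shatter (2 * n)))"
      using eventually_gt_at_top[of 0]
    proof eventually_elim
      case (elim n)
      then have "real (n\<^sup>2) \<le> real (shatter (2 * n))"
        using shatter_ge of_nat_mono by blast
      then show ?case
        using elim by simp
    qed
  qed
  also have "(\<lambda>n. real (shatter (2 * n))) \<in> O(\<lambda>n. real (2 * n) powr r)"
    using assms by (rule landau_o.big.compose) (rule mult_nat_left_at_top, simp)
  also have "(\<lambda>n. real (2 * n) powr r) = (\<lambda>n. 2 powr r * real n powr r)"
    by (simp add: powr_mult)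
  also have "O(\<lambda>n. 2 powr r * real n powr r) = O(\<lambda>n. real n powr r)"
    by simp
  finally show ?thesis
    by (subst (asm) powr_bigo_iff) (simp_all add: filterlim_real_sequentially)
qed

text \<open>The infimum is attained: 2 is itself an admissible exponent and no smaller one
  is.\<close>

lemma vc_density_interval_or_coset:
  "vc_density (pair_structure scale unit W) 1 1 interval_or_coset = 2"
proof (rule antisym)
  show "vc_density (pair_structure scale unit W) 1 1 interval_or_coset \<le> 2"
    unfolding vc_density_def using shatter_bigo by (intro Inf_lower) force
  show "2 \<le> vc_density (pair_structure scale unit W) 1 1 interval_or_coset"
    unfolding vc_density_def using two_le_if_shatter_bigo by (intro Inf_greatest) auto
qed

end

theorem corollary3p7:
  fixes scale :: "'k::linordered_field \<Rightarrow> 'v::linordered_ab_group_add \<Rightarrow> 'v"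
    and unit :: 'v and W :: "'v set"
  assumes "dense_pair scale unit W"
  shows "vc_density (pair_structure scale unit W) 1 1 interval_or_coset = 2"
  using assms by (rule dense_pair.vc_density_interval_or_coset)

end
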